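(* There exist arbitrarily large $k\in\mathbb{N}$ such that for every $n\in\mathbb{N}$ with $\frac n2<k<n$ there exists a convex body $L$ in $\mathbb{R}^n$ which is in John's position and satisfies $$\mathrm{vol}_k(L\cap H)=\left(\frac nk\right)^{\frac k2}\mathrm{vol}_k(B_\infty^k)>2^{\frac{n-k}{2}}\,\mathrm{vol}_k(B_\infty^k),$$ where $H=\mathrm{span}\{e_1,\dots,e_k\}$ and $(e_i)_{i=1}^n$ is the canonical basis of $\mathbb{R}^n$.
   Context: A convex body $L\subseteq\mathbb{R}^n$ is in John's position if the maximal volume ellipsoid contained in $L$ is the Euclidean unit ball $B_2^n$. $B_\infty^k=[-1,1]^k$. $\mathrm{vol}_k$ is $k$-dimensional volume. *)

theory Defs
  imports "HOL-Analysis.Analysis" "HOL-Library.Function_Algebras"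
begin

(* R^n is the carrier of Euclidean_space n: the sequences of type nat => real that vanish
   from index n on. Hence R^k is literally the coordinate subspace spanned by the first k
   basis vectors of R^n when k <= n. The topology of the library on this carrier is that of
   coordinatewise convergence, which for finitely many coordinates is the usual one.
   Coordinates are numbered from 0. *)

abbreviation Rn :: "nat \<Rightarrow> (nat \<Rightarrow> real) set" where
  "Rn n \<equiv> topspace (Euclidean_space n)"

(* The pointwise vector space structure; it makes convex, span and linear available. *)
instantiation "fun" :: (type, real_vector) real_vector
begin

definition scaleR_fun :: "real \<Rightarrow> ('a \<Rightarrow> 'b) \<Rightarrow> 'a \<Rightarrow> 'b" where
  "scaleR_fun c f = (\<lambda>x. c *\<^sub>R f x)"

instance
  by standard (simp_all add: scaleR_fun_def fun_eq_iff scaleR_add_right scaleR_add_left)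

end

definition std_basis :: "nat \<Rightarrow> nat \<Rightarrow> real" where
  "std_basis i = (\<lambda>j. if j = i then 1 else 0)"

definition unit_ball :: "nat \<Rightarrow> (nat \<Rightarrow> real) set" where
  "unit_ball n = {x \<in> Rn n. L2_set x {..<n} \<le> 1}"

definition cube :: "nat \<Rightarrow> (nat \<Rightarrow> real) set" where
  "cube n = {x \<in> Rn n. \<forall>i<n. x i \<in> {-1..1}}"

(* The product of n copies of one-dimensional Lebesgue measure, pushed forward from the
   extensional functions on {..<n} to the sequences supported on {..<n}. It is concentrated
   on R^n, so measuring a subset of R^k with lborel_Rn k gives its k-dimensional volume. *)
definition lborel_Rn :: "nat \<Rightarrow> (nat \<Rightarrow> real) measure" where
  "lborel_Rn n =
     distr (\<Pi>\<^sub>M i\<in>{..<n}. lborel) borel (\<lambda>x i. if i < n then x i else 0)"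

definition vol :: "nat \<Rightarrow> (nat \<Rightarrow> real) set \<Rightarrow> real" where
  "vol n A = measure (lborel_Rn n) A"

definition convex_body :: "nat \<Rightarrow> (nat \<Rightarrow> real) set \<Rightarrow> bool" where
  "convex_body n L \<longleftrightarrow>
     convex L \<and> compactin (Euclidean_space n) L \<and> Euclidean_space n interior_of L \<noteq> {}"

(* Images of the unit ball under invertible affine maps of R^n. The linear map T is given on
   all sequences, but only its restriction to R^n matters, and every linear map of R^n to
   itself extends. Mapping R^n onto R^n makes that restriction invertible. *)
definition ellipsoid :: "nat \<Rightarrow> (nat \<Rightarrow> real) set \<Rightarrow> bool" where
  "ellipsoid n E \<longleftrightarrow>
     (\<exists>c T. c \<in> Rn n \<and> linear T \<and> T ` Rn n = Rn n \<and> E = (\<lambda>x. c + T x) ` unit_ball n)"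

definition max_volume_ellipsoid :: "nat \<Rightarrow> (nat \<Rightarrow> real) set \<Rightarrow> (nat \<Rightarrow> real) set \<Rightarrow> bool" where
  "max_volume_ellipsoid n L E \<longleftrightarrow>
     ellipsoid n E \<and> E \<subseteq> L \<and> (\<forall>E'. ellipsoid n E' \<and> E' \<subseteq> L \<longrightarrow> vol n E' \<le> vol n E)"

(* The unit ball is the unique ellipsoid of maximal volume inside L. *)
definition john_position :: "nat \<Rightarrow> (nat \<Rightarrow> real) set \<Rightarrow> bool" where
  "john_position n L \<longleftrightarrow> (\<forall>E. max_volume_ellipsoid n L E \<longleftrightarrow> E = unit_ball n)"

lemma pad_measurable:
  "(\<lambda>x i. if i < n then x i else 0) \<in> (\<Pi>\<^sub>M i\<in>{..<n}. lborel) \<rightarrow>\<^sub>M (borel :: (nat \<Rightarrow> real) measure)"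
proof (rule measurable_coordinatewise_then_product)
  fix i
  show "(\<lambda>x. if i < n then x i else 0) \<in> borel_measurable (\<Pi>\<^sub>M i\<in>{..<n}. (lborel :: real measure))"
    by (cases "i < n") (auto simp: intro: measurable_component_singleton
        measurable_compose[OF measurable_component_singleton[of i "{..<n}"]])
qed

lemma vol_cube: "vol n (cube n) = 2 ^ n"
proof -
  interpret finite_product_sigma_finite "\<lambda>_. lborel :: real measure" "{..<n}"
    by standard auto
  let ?pad = "\<lambda>x i. if i < n then x i else (0::real)"
  have cube: "cube n = (\<Inter>i. {x. x i \<in> (if i < n then {-1..1} else {0})})"
  proof (intro equalityI subsetI)
    fix x :: "nat \<Rightarrow> real" assume "x \<in> (\<Inter>i. {x. x i \<in> (if i < n then {-1..1} else {0})})"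
    then have *: "x i \<in> (if i < n then {-1..1} else {0})" for i
      by blast
    have "x i \<in> {-1..1}" if "i < n" for i
      using *[of i] that by simp
    moreover have "x i = 0" if "i \<ge> n" for i
      using *[of i] that by simp
    ultimately show "x \<in> cube n"
      unfolding cube_def topspace_Euclidean_space by blast
  next
    fix x assume "x \<in> cube n"
    then have "x i \<in> (if i < n then {-1..1} else {0})" for i
      unfolding cube_def topspace_Euclidean_space by (cases "i < n") simp_all
    then show "x \<in> (\<Inter>i. {x. x i \<in> (if i < n then {-1..1} else {0})})"
      by blast
  qed
  have "{x. x i \<in> (if i < n then {-1..1} else {0::real})} \<in> sets borel" for i
  proof -
    have "closed ((\<lambda>x::nat \<Rightarrow> real. x i) -` (if i < n then {-1..1} else {0}))"
      by (intro closed_vimage continuous_on_product_coordinates) auto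
    then show ?thesis
      by (simp add: vimage_def borel_closed)
  qed
  then have "cube n \<in> sets borel"
    unfolding cube by (intro sets.countable_INT'') simp_all
  then have "vol n (cube n)
      = measure (\<Pi>\<^sub>M i\<in>{..<n}. lborel) (?pad -` cube n \<inter> space (\<Pi>\<^sub>M i\<in>{..<n}. lborel))"
    unfolding vol_def lborel_Rn_def by (rule measure_distr[OF pad_measurable])
  also have "?pad -` cube n \<inter> space (\<Pi>\<^sub>M i\<in>{..<n}. lborel) = (\<Pi>\<^sub>E i\<in>{..<n}. {-1..1::real})"
  proof -
    have "?pad x \<in> cube n \<longleftrightarrow> (\<forall>i\<in>{..<n}. x i \<in> {-1..1})" for x
      unfolding cube_def topspace_Euclidean_space by (simp add: Ball_def)
    then show ?thesis
      unfolding space_PiM space_lborel space_borel PiE_def Pi_def by blast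
  qed
  also have "measure (\<Pi>\<^sub>M i\<in>{..<n}. lborel) \<dots> = 2 ^ n"
  proof -
    have "emeasure (\<Pi>\<^sub>M i\<in>{..<n}. lborel) (\<Pi>\<^sub>E i\<in>{..<n}. {-1..1::real})
        = (\<Prod>i\<in>{..<n}. emeasure lborel {-1..1::real})"
      by (rule measure_times) simp
    also have "\<dots> = ennreal (2 ^ n)"
      by (simp add: ennreal_power flip: ennreal_numeral)
    finally show ?thesis
      by (simp add: measure_def)
  qed
  finally show ?thesis .
qed

lemma span_std_basis: "span (std_basis ` {..<k}) = Rn k"
proof (intro equalityI subsetI)
  fix x assume "x \<in> span (std_basis ` {..<k})"
  then show "x \<in> Rn k"
    by (induction rule: span_induct_alt)
      (auto simp: topspace_Euclidean_space std_basis_def scaleR_fun_def)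
next
  fix x assume x: "x \<in> Rn k"
  have "(\<Sum>i<m. x i *\<^sub>R std_basis i) = (\<lambda>j. if j < m then x j else 0)" for m
    by (induction m) (auto simp: fun_eq_iff std_basis_def scaleR_fun_def less_Suc_eq)
  moreover have "(\<lambda>j. if j < k then x j else 0) = x"
    using x by (auto simp: topspace_Euclidean_space fun_eq_iff)
  moreover have "(\<Sum>i<k. x i *\<^sub>R std_basis i) \<in> span (std_basis ` {..<k})"
    by (intro span_sum span_scale span_base) auto
  ultimately show "x \<in> span (std_basis ` {..<k})" by simp
qed

end

theory Submission
  imports Defs
begin

text \<open>
  Let \<open>k\<close> be a power of 2, \<open>k < n < 2 k\<close>, and let \<open>h\<close> be a Hadamard matrix of order \<open>k\<close>. The body is
  \<open>L = {x. \<bar>\<langle>u, x\<rangle>\<bar> \<le> 1 for all u}\<close>, where \<open>u\<close> runs over the \<open>2 k\<close> unit vectors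
  \<open>(sqrt (k / n) e\<^sub>i, \<plusminus> h\<^sub>i / sqrt n)\<close> for \<open>i < k\<close>, and \<open>h\<^sub>i\<close> is row \<open>i\<close> of \<open>h\<close> cut to its first \<open>n - k\<close>
  entries. On the coordinate subspace of dimension \<open>k\<close> such a \<open>u\<close> acts as \<open>sqrt (k / n) e\<^sub>i\<close>, so the
  section of \<open>L\<close> is a cube of half side \<open>sqrt (n / k)\<close> (\<open>contact_body_section\<close>), which has the
  volume claimed. The strict lower bound is the inequality \<open>2 powr (t - 1) < t\<close> for \<open>t = n / k\<close>,
  strictly between 1 and 2, raised to the power \<open>k / 2\<close>.

  Orthogonality of the columns of \<open>h\<close>, together with the two signs, shows that the \<open>u\<close> with equal
  weights \<open>n / (2 k)\<close> decompose the identity (\<open>john_decomposition_contact_point\<close>). That \<open>L\<close> is then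
  in John's position is the sufficient half of John's theorem, in the symmetric case
  (\<open>john_position_symmetric_body\<close>). By Gram-Schmidt every ellipsoid is the image of the ball under
  an affine map \<open>x \<mapsto> c + R x\<close> with \<open>R\<close> lower triangular of positive diagonal
  (\<open>ellipsoid_lower_affine\<close>), and integrating one coordinate at a time shows that its volume is
  that of the ball times the product of the diagonal (\<open>vol_lower_affine\<close>). Containment in \<open>L\<close>
  and the decomposition bound the trace of \<open>R\<close> by \<open>n\<close>, hence the product by 1; equality forces \<open>c = 0\<close>
  and \<open>R = 1\<close> (\<open>contained_ellipsoid\<close>).
\<close>

section \<open>Inner products of finite sequences\<close>

definition dot :: "nat \<Rightarrow> (nat \<Rightarrow> real) \<Rightarrow> (nat \<Rightarrow> real) \<Rightarrow> real" where
  "dot n x y = (\<Sum>i<n. x i * y i)"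

lemma unit_ball_iff: "x \<in> unit_ball n \<longleftrightarrow> x \<in> Rn n \<and> dot n x x \<le> 1"
  by (auto simp: unit_ball_def L2_set_def dot_def power2_eq_square real_sqrt_le_1_iff)

lemma Rn_iff: "x \<in> Rn n \<longleftrightarrow> (\<forall>i\<ge>n. x i = 0)"
  by (simp add: topspace_Euclidean_space)

lemma dot_commute: "dot n x y = dot n y x"
  by (simp add: dot_def mult.commute)

lemma dot_nonneg: "0 \<le> dot n x x"
  by (auto simp: dot_def intro: sum_nonneg)

lemma dot_eq_0_iff: "dot n x x = 0 \<longleftrightarrow> (\<forall>i<n. x i = 0)"
  by (auto simp: dot_def sum_nonneg_eq_0_iff)

lemma dot_scale: "dot n (\<lambda>i. a * x i) y = a * dot n x y"
  by (simp add: dot_def sum_distrib_left mult.assoc)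

lemma dot_diff: "dot n (\<lambda>i. x i - y i) z = dot n x z - dot n y z"
  by (simp add: dot_def sum_subtractf left_diff_distrib)

lemma dot_square_diff:
  "dot n (\<lambda>i. x i - y i) (\<lambda>i. x i - y i) = dot n x x - 2 * dot n x y + dot n y y"
  unfolding dot_def by (simp add: algebra_simps sum.distrib sum_subtractf sum_distrib_left)

lemma dot_sum: "dot n (\<lambda>i. \<Sum>l\<in>A. x l i) y = (\<Sum>l\<in>A. dot n (x l) y)"
  unfolding dot_def by (subst sum.swap) (simp add: sum_distrib_right)

lemma abs_dot_le_1:
  assumes "dot n x x \<le> 1" "dot n y y \<le> 1"
  shows "\<bar>dot n x y\<bar> \<le> 1"
proof -
  have "(dot n x y)\<^sup>2 \<le> dot n x x * dot n y y"
    using Cauchy_Schwarz_ineq_sum[of x y "{..<n}"] by (simp add: dot_def power2_eq_square)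
  also have "\<dots> \<le> 1 * 1"
    by (intro mult_mono assms dot_nonneg) auto
  finally show ?thesis
    by (simp add: abs_square_le_1)
qed

section \<open>Compact subsets of the coordinate space\<close>

text \<open>
  Tychonoff's theorem, since the carrier consists of infinite sequences: the box is a product
  of intervals, degenerate from coordinate \<open>n\<close> on.
\<close>

lemma compact_Rn_box: "compact {x \<in> Rn n. \<forall>i<n. \<bar>x i\<bar> \<le> M}"
proof -
  have "{x \<in> Rn n. \<forall>i<n. \<bar>x i\<bar> \<le> M} = PiE UNIV (\<lambda>i. if i < n then {-M..M} else {0})"
  proof (rule set_eqI)
    fix x :: "nat \<Rightarrow> real"
    have "x i \<in> (if i < n then {-M..M} else {0}) \<longleftrightarrow> (i < n \<longrightarrow> \<bar>x i\<bar> \<le> M) \<and> (i \<ge> n \<longrightarrow> x i = 0)" for i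
      by auto
    then show "x \<in> {x \<in> Rn n. \<forall>i<n. \<bar>x i\<bar> \<le> M} \<longleftrightarrow> x \<in> PiE UNIV (\<lambda>i. if i < n then {-M..M} else {0})"
      unfolding PiE_UNIV_domain Pi_iff Rn_iff by blast
  qed
  moreover have "compactin (product_topology (\<lambda>i. euclidean) UNIV)
      (PiE UNIV (\<lambda>i. if i < n then {-M..M::real} else {0}))"
    by (subst compactin_PiE) auto
  ultimately show ?thesis
    by (simp add: euclidean_product_topology)
qed

lemma compact_Rn:
  assumes "closed A" "\<And>x i. x \<in> A \<inter> Rn n \<Longrightarrow> i < n \<Longrightarrow> \<bar>x i\<bar> \<le> M"
  shows "compact (A \<inter> Rn n)"
proof -
  have "A \<inter> Rn n = A \<inter> {x \<in> Rn n. \<forall>i<n. \<bar>x i\<bar> \<le> M}"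
    using assms(2) by auto
  then show ?thesis
    using closed_Int_compact[OF assms(1) compact_Rn_box[of n M]] by simp
qed

lemma Euclidean_space_eq_subtopology: "Euclidean_space n = subtopology euclidean (Rn n)"
  by (simp add: Euclidean_space_def euclidean_product_topology topspace_Euclidean_space)

lemma compactin_Euclidean_space:
  "compactin (Euclidean_space n) A \<longleftrightarrow> compact A \<and> A \<subseteq> Rn n"
  by (metis Euclidean_space_eq_subtopology compactin_subtopology compactin_euclidean_iff)

lemma continuous_dot: "continuous_on UNIV (dot n u)"
  unfolding dot_def[abs_def] by (intro continuous_intros continuous_on_product_coordinates)

lemma coord_le_dot: "i < n \<Longrightarrow> (x i)\<^sup>2 \<le> dot n x x"
  unfolding dot_def power2_eq_square by (rule member_le_sum) auto

lemma compact_unit_ball: "compact (unit_ball n)"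
proof -
  have "closed {x. dot n x x \<le> 1}"
    unfolding dot_def
    by (intro closed_Collect_le continuous_intros continuous_on_product_coordinates)
  moreover have "\<bar>x i\<bar> \<le> 1" if "x \<in> {x. dot n x x \<le> 1} \<inter> Rn n" "i < n" for x i
    using that coord_le_dot[of i n x] by (simp flip: abs_square_le_1)
  moreover have "unit_ball n = {x. dot n x x \<le> 1} \<inter> Rn n"
    by (auto simp: unit_ball_iff)
  ultimately show ?thesis
    using compact_Rn[of "{x. dot n x x \<le> 1}" n 1] by simp
qed

section \<open>Triangular affine maps and volume\<close>

text \<open>
  The lower triangular affine maps suffice to describe ellipsoids, and their triangular shape
  lets volume and injectivity be read off one coordinate at a time.
\<close>

definition lower_affine :: "nat \<Rightarrow> (nat \<Rightarrow> real) \<Rightarrow> (nat \<Rightarrow> nat \<Rightarrow> real) \<Rightarrow> (nat \<Rightarrow> real) \<Rightarrow> nat \<Rightarrow> real" where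
  "lower_affine n c R x = (\<lambda>i. if i < n then c i + (\<Sum>l\<le>i. R i l * x l) else 0)"

lemma continuous_lower_affine: "continuous_on UNIV (lower_affine n c R)"
proof (rule continuous_on_coordinatewise_then_product)
  fix i show "continuous_on UNIV (\<lambda>x. lower_affine n c R x i)"
    unfolding lower_affine_def
    by (cases "i < n") (auto intro!: continuous_intros continuous_on_product_coordinates)
qed

lemma measurable_lower_affine: "lower_affine n c R \<in> borel \<rightarrow>\<^sub>M borel"
  by (rule borel_measurable_continuous_onI[OF continuous_lower_affine])

lemma sets_lborel_Rn [simp]: "sets (lborel_Rn n) = sets borel"
  by (simp add: lborel_Rn_def)

lemma measurable_fun_upd_borel:
  "(\<lambda>(x :: nat \<Rightarrow> real, y). x(n := y)) \<in> borel_measurable (borel \<Otimes>\<^sub>M lborel)"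
proof (rule measurable_coordinatewise_then_product)
  fix i
  have [measurable]: "(\<lambda>x :: nat \<Rightarrow> real. x i) \<in> borel_measurable borel"
    by (rule measurable_product_coordinates)
  show "(\<lambda>z. (case z of (x :: nat \<Rightarrow> real, y) \<Rightarrow> x(n := y)) i) \<in> borel_measurable (borel \<Otimes>\<^sub>M lborel)"
    by (cases "i = n") (auto simp: case_prod_beta)
qed

text \<open>
  Tonelli's theorem for the padded product measure, splitting off the last coordinate; this is
  the induction step of the change of variables below.
\<close>

lemma nn_integral_lborel_Rn_Suc:
  assumes g: "g \<in> borel_measurable borel"
  shows "(\<integral>\<^sup>+x. g x \<partial>lborel_Rn (Suc n)) = (\<integral>\<^sup>+x. (\<integral>\<^sup>+y. g (x(n := y)) \<partial>lborel) \<partial>lborel_Rn n)"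
proof -
  interpret product_sigma_finite "\<lambda>_. lborel :: real measure"
    by standard
  let ?pad = "\<lambda>n x i. if i < n then x i else (0::real)"
  note [measurable] = g pad_measurable
  have [measurable]: "(\<lambda>x. \<integral>\<^sup>+y. g (x(n := y)) \<partial>lborel) \<in> borel_measurable borel"
    using measurable_compose[OF measurable_fun_upd_borel[of n] g]
    by (intro lborel.borel_measurable_nn_integral) (simp only: case_prod_unfold)
  have "(\<integral>\<^sup>+x. g x \<partial>lborel_Rn (Suc n)) = (\<integral>\<^sup>+x. g (?pad (Suc n) x) \<partial>Pi\<^sub>M (insert n {..<n}) (\<lambda>_. lborel))"
    unfolding lborel_Rn_def lessThan_Suc
    using pad_measurable[of "Suc n"] by (subst nn_integral_distr) (auto simp: g lessThan_Suc)
  also have "\<dots> = (\<integral>\<^sup>+x. (\<integral>\<^sup>+y. g (?pad (Suc n) (x(n := y))) \<partial>lborel) \<partial>Pi\<^sub>M {..<n} (\<lambda>_. lborel))"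
    using measurable_compose[OF pad_measurable[of "Suc n"] g]
    by (intro product_nn_integral_insert) (auto simp: lessThan_Suc)
  also have "\<dots> = (\<integral>\<^sup>+x. (\<integral>\<^sup>+y. g ((?pad n x)(n := y)) \<partial>lborel) \<partial>Pi\<^sub>M {..<n} (\<lambda>_. lborel))"
    by (intro nn_integral_cong arg_cong[of _ _ g]) (auto simp: fun_eq_iff)
  also have "(\<integral>\<^sup>+x. (\<integral>\<^sup>+y. g ((?pad n x)(n := y)) \<partial>lborel) \<partial>Pi\<^sub>M {..<n} (\<lambda>_. lborel))
      = (\<integral>\<^sup>+x. (\<integral>\<^sup>+y. g (x(n := y)) \<partial>lborel) \<partial>lborel_Rn n)"
    unfolding lborel_Rn_def by (subst nn_integral_distr) auto
  finally show ?thesis .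
qed

text \<open>
  By triangularity the last output coordinate depends on the last input coordinate only through
  a one-dimensional affine map, with slope the last diagonal entry, and the other outputs do not
  depend on that input at all. So the last integral contributes exactly that slope.
\<close>

lemma nn_integral_lower_affine:
  assumes "g \<in> borel_measurable borel" "\<And>i. i < n \<Longrightarrow> 0 < R i i"
  shows "(\<integral>\<^sup>+x. g x \<partial>lborel_Rn n)
    = ennreal (\<Prod>i<n. R i i) * (\<integral>\<^sup>+x. g (lower_affine n c R x) \<partial>lborel_Rn n)"
  using assms
proof (induction n arbitrary: g)
  case 0
  let ?z = "\<lambda>_::nat. 0::real"
  have "(\<integral>\<^sup>+x. g x \<partial>lborel_Rn 0) = (\<integral>\<^sup>+x. g (lower_affine 0 c R x) \<partial>lborel_Rn 0)"
    unfolding lborel_Rn_def lower_affine_def using 0(1) pad_measurable[of 0]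
    by (subst (1 2) nn_integral_distr) (auto intro: measurable_compose)
  then show ?case by simp
next
  case (Suc n)
  note g = Suc.prems(1)
  let ?b = "\<lambda>x. c n + (\<Sum>l<n. R n l * x l)"
  let ?G = "\<lambda>x. \<integral>\<^sup>+z. g (x(n := z)) \<partial>lborel"
  have G: "?G \<in> borel_measurable borel"
    using measurable_compose[OF measurable_fun_upd_borel[of n] g]
    by (intro lborel.borel_measurable_nn_integral) (simp only: case_prod_unfold)
  have gx: "(\<lambda>z. g (x(n := z))) \<in> borel_measurable borel" for x
    using measurable_compose[OF measurable_Pair1'[of x borel lborel]
        measurable_compose[OF measurable_fun_upd_borel[of n] g]] by (simp add: fun_upd_def)
  have upd: "lower_affine (Suc n) c R (x(n := y)) = (lower_affine n c R x)(n := ?b x + R n n * y)" for x y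
  proof
    fix i
    have *: "(\<Sum>l\<le>n. R n l * (x(n := y)) l) = (\<Sum>l<n. R n l * x l) + R n n * y"
      by (simp add: lessThan_Suc_atMost[symmetric])
    have **: "(\<Sum>l\<le>i. R i l * (x(n := y)) l) = (\<Sum>l\<le>i. R i l * x l)" if "i < n"
      using that by (intro sum.cong) auto
    show "lower_affine (Suc n) c R (x(n := y)) i = ((lower_affine n c R x)(n := ?b x + R n n * y)) i"
      using * ** by (cases "i = n") (auto simp: lower_affine_def)
  qed
  have inner: "?G (lower_affine n c R x)
      = ennreal (R n n) * (\<integral>\<^sup>+y. g (lower_affine (Suc n) c R (x(n := y))) \<partial>lborel)" for x
    unfolding upd using Suc.prems(2)[of n]
    by (subst nn_integral_real_affine[where c = "R n n" and t = "?b x", OF gx]) auto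
  have "(\<integral>\<^sup>+x. g x \<partial>lborel_Rn (Suc n)) = (\<integral>\<^sup>+x. ?G x \<partial>lborel_Rn n)"
    by (rule nn_integral_lborel_Rn_Suc[OF g])
  also have "\<dots> = ennreal (\<Prod>i<n. R i i) * (\<integral>\<^sup>+x. ?G (lower_affine n c R x) \<partial>lborel_Rn n)"
    by (intro Suc.IH G Suc.prems(2)) auto
  also have "(\<integral>\<^sup>+x. ?G (lower_affine n c R x) \<partial>lborel_Rn n)
      = ennreal (R n n) * (\<integral>\<^sup>+x. (\<integral>\<^sup>+y. g (lower_affine (Suc n) c R (x(n := y))) \<partial>lborel) \<partial>lborel_Rn n)"
    unfolding inner
  proof (rule nn_integral_cmult)
    have "(\<lambda>x. \<integral>\<^sup>+y. g (lower_affine (Suc n) c R (x(n := y))) \<partial>lborel) \<in> borel_measurable borel"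
      using measurable_compose[OF measurable_fun_upd_borel[of n] measurable_compose[OF measurable_lower_affine g]]
      by (intro lborel.borel_measurable_nn_integral) (simp only: case_prod_unfold)
    then show "(\<lambda>x. \<integral>\<^sup>+y. g (lower_affine (Suc n) c R (x(n := y))) \<partial>lborel) \<in> borel_measurable (lborel_Rn n)"
      by (simp add: measurable_cong_sets[OF sets_lborel_Rn refl])
  qed
  also have "(\<integral>\<^sup>+x. (\<integral>\<^sup>+y. g (lower_affine (Suc n) c R (x(n := y))) \<partial>lborel) \<partial>lborel_Rn n)
      = (\<integral>\<^sup>+x. g (lower_affine (Suc n) c R x) \<partial>lborel_Rn (Suc n))"
    by (rule nn_integral_lborel_Rn_Suc[symmetric]) (rule measurable_compose[OF measurable_lower_affine g])
  also have "ennreal (\<Prod>i<n. R i i) * (ennreal (R n n) * I) = ennreal (\<Prod>i<Suc n. R i i) * I" for I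
  proof -
    have "0 \<le> (\<Prod>i<n. R i i)" "0 \<le> R n n"
      using Suc.prems(2) by (auto intro!: prod_nonneg intro: less_imp_le)
    then show ?thesis by (simp add: ennreal_mult mult.assoc)
  qed
  finally show ?case .
qed

lemma inj_on_lower_affine:
  assumes "\<And>i. i < n \<Longrightarrow> 0 < R i i"
  shows "inj_on (lower_affine n c R) (Rn n)"
proof (rule inj_onI)
  fix x y assume xy: "x \<in> Rn n" "y \<in> Rn n" and eq: "lower_affine n c R x = lower_affine n c R y"
  have "x i = y i" if "i < n" for i
    using that
  proof (induction i rule: less_induct)
    case (less i)
    have "(\<Sum>l\<le>i. R i l * x l) = (\<Sum>l\<le>i. R i l * y l)"
      using fun_cong[OF eq, of i] less.prems by (simp add: lower_affine_def)
    moreover have "(\<Sum>l<i. R i l * x l) = (\<Sum>l<i. R i l * y l)"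
      using less by (intro sum.cong) auto
    ultimately show ?case
      using assms[OF less.prems] by (simp add: lessThan_Suc_atMost[symmetric])
  qed
  then show "x = y"
    using xy by (metis Rn_iff ext linorder_not_less)
qed

text \<open>
  The measure lives on \<open>Rn n\<close>, so a preimage may be compared with the original set there,
  whatever it contains off \<open>Rn n\<close>, where a triangular map is not injective.
\<close>

lemma emeasure_lborel_Rn_cong:
  assumes "A \<in> sets borel" "B \<in> sets borel" "A \<inter> Rn n = B \<inter> Rn n"
  shows "emeasure (lborel_Rn n) A = emeasure (lborel_Rn n) B"
proof -
  let ?pad = "\<lambda>n x i. if i < n then x i else (0::real)"
  have "?pad n x \<in> Rn n" for x by (simp add: Rn_iff)
  then have "?pad n -` A = ?pad n -` B"
    using assms(3) by blast
  then show ?thesis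
    unfolding lborel_Rn_def by (simp add: emeasure_distr[OF pad_measurable] assms)
qed

lemma vol_lower_affine:
  assumes R: "\<And>i. i < n \<Longrightarrow> 0 < R i i" and A: "compact (A :: (nat \<Rightarrow> real) set)" "A \<subseteq> Rn n"
  shows "vol n (lower_affine n c R ` A) = (\<Prod>i<n. R i i) * vol n A"
proof -
  let ?f = "lower_affine n c R"
  have A': "A \<in> sets borel" "?f ` A \<in> sets borel"
    using A compact_continuous_image[OF continuous_on_subset[OF continuous_lower_affine[of n c R]], of A]
    by (auto intro: borel_compact)
  have f': "?f -` (?f ` A) \<in> sets borel"
    using measurable_sets_borel[OF measurable_lower_affine A'(2)] by simp
  have pre: "?f -` (?f ` A) \<inter> Rn n = A \<inter> Rn n"
    using inj_on_lower_affine[of n R c, OF R] A(2) by (auto dest: inj_onD)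
  have "emeasure (lborel_Rn n) (?f ` A) = (\<integral>\<^sup>+x. indicator (?f ` A) x \<partial>lborel_Rn n)"
    using A' by simp
  also have "\<dots> = ennreal (\<Prod>i<n. R i i) * (\<integral>\<^sup>+x. indicator (?f ` A) (?f x) \<partial>lborel_Rn n)"
    using A' R by (intro nn_integral_lower_affine) auto
  also have "(\<integral>\<^sup>+x. indicator (?f ` A) (?f x) \<partial>lborel_Rn n) = (\<integral>\<^sup>+x. indicator (?f -` (?f ` A)) x \<partial>lborel_Rn n)"
    by (intro nn_integral_cong) (simp add: indicator_def)
  also have "\<dots> = emeasure (lborel_Rn n) A"
    using f' emeasure_lborel_Rn_cong[OF f' A'(1) pre] by simp
  finally have "vol n (?f ` A) = enn2real (ennreal (\<Prod>i<n. R i i)) * vol n A"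
    by (simp add: vol_def measure_def enn2real_mult)
  moreover have "0 \<le> (\<Prod>i<n. R i i)"
    using R by (intro prod_nonneg) (auto intro: less_imp_le)
  ultimately show ?thesis by simp
qed

lemma cube_eq: "cube n = {x \<in> Rn n. \<forall>i<n. \<bar>x i\<bar> \<le> 1}"
proof -
  have "a \<in> {-1..1} \<longleftrightarrow> \<bar>a\<bar> \<le> 1" for a :: real
    by auto
  then show ?thesis by (simp only: cube_def)
qed

lemma lower_affine_scale:
  "x \<in> Rn n \<Longrightarrow> lower_affine n (\<lambda>_. 0) (\<lambda>i l. if i = l then s else 0) x = (\<lambda>i. s * x i)"
proof -
  have "(\<Sum>l\<le>i. (if i = l then s else 0) * x l) = (\<Sum>l\<le>i. if i = l then s * x l else 0)" for i
    by (intro sum.cong) auto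
  then show "x \<in> Rn n \<Longrightarrow> lower_affine n (\<lambda>_. 0) (\<lambda>i l. if i = l then s else 0) x = (\<lambda>i. s * x i)"
    by (auto simp: lower_affine_def fun_eq_iff Rn_iff)
qed

lemma vol_scaled_cube:
  assumes "s > 0"
  shows "vol n {x \<in> Rn n. \<forall>i<n. \<bar>x i\<bar> \<le> s} = s ^ n * vol n (cube n)"
proof -
  let ?f = "lower_affine n (\<lambda>_. 0) (\<lambda>i l. if i = l then s else 0)"
  have "{x \<in> Rn n. \<forall>i<n. \<bar>x i\<bar> \<le> s} = ?f ` cube n"
  proof (intro equalityI subsetI)
    fix x assume x: "x \<in> {x \<in> Rn n. \<forall>i<n. \<bar>x i\<bar> \<le> s}"
    then have "(\<lambda>i. x i / s) \<in> cube n"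
      using assms by (simp add: cube_eq Rn_iff)
    moreover have "x = ?f (\<lambda>i. x i / s)"
      using x assms by (subst lower_affine_scale) (auto simp: Rn_iff)
    ultimately show "x \<in> ?f ` cube n" by blast
  next
    fix y assume "y \<in> ?f ` cube n"
    then show "y \<in> {x \<in> Rn n. \<forall>i<n. \<bar>x i\<bar> \<le> s}"
      using assms by (auto simp: lower_affine_scale cube_eq Rn_iff abs_mult)
  qed
  moreover have "vol n (?f ` cube n) = s ^ n * vol n (cube n)"
    using assms compact_Rn_box[of n 1] by (subst vol_lower_affine) (auto simp: cube_eq)
  ultimately show ?thesis by simp
qed

text \<open>
  Finiteness of the measure of the ball has to be shown too, as \<open>measure\<close> sends infinity to 0;
  it comes from the circumscribed cube, and positivity from a small inscribed one.
\<close>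

lemma vol_unit_ball_pos: "vol n (unit_ball n) > 0"
proof -
  let ?C = "{x \<in> Rn n. \<forall>i<n. \<bar>x i\<bar> \<le> 1 / (real n + 1)}"
  have sub: "unit_ball n \<subseteq> cube n"
  proof
    fix x assume x: "x \<in> unit_ball n"
    have "\<bar>x i\<bar> \<le> 1" if "i < n" for i
      using x coord_le_dot[OF that, of x] by (simp add: unit_ball_iff flip: abs_square_le_1)
    then show "x \<in> cube n"
      using x by (simp add: unit_ball_iff cube_eq)
  qed
  have "emeasure (lborel_Rn n) (cube n) \<noteq> \<infinity>"
    using vol_cube[of n] by (auto simp: vol_def measure_def)
  moreover have "cube n \<in> sets borel"
    unfolding cube_eq by (rule borel_compact[OF compact_Rn_box])
  ultimately have "cube n \<in> fmeasurable (lborel_Rn n)"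
    by (simp add: fmeasurable_def less_top)
  then have fm: "unit_ball n \<in> fmeasurable (lborel_Rn n)"
    using sub by (rule fmeasurableI2) (simp add: borel_compact[OF compact_unit_ball])
  have "?C \<subseteq> unit_ball n"
  proof
    fix x assume x: "x \<in> ?C"
    have "dot n x x \<le> (\<Sum>i<n. 1 / (real n + 1))"
      unfolding dot_def
    proof (rule sum_mono)
      fix i assume "i \<in> {..<n}"
      then have "\<bar>x i\<bar> \<le> 1 / (real n + 1)" using x by simp
      moreover from this have "\<bar>x i\<bar> \<le> 1" by (rule order_trans) simp
      ultimately have "\<bar>x i\<bar> * \<bar>x i\<bar> \<le> 1 * (1 / (real n + 1))"
        by (intro mult_mono) auto
      then show "x i * x i \<le> 1 / (real n + 1)" by simp
    qed
    also have "\<dots> \<le> 1" by simp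
    finally show "x \<in> unit_ball n" using x by (simp add: unit_ball_iff)
  qed
  then have "vol n ?C \<le> vol n (unit_ball n)"
    unfolding vol_def
    by (rule measure_mono_fmeasurable) (simp_all add: borel_compact[OF compact_Rn_box] fm)
  moreover have "vol n ?C > 0"
    by (subst vol_scaled_cube) (auto simp: vol_cube)
  ultimately show ?thesis by linarith
qed

section \<open>Triangular form of ellipsoids\<close>

lemma sum_fun_apply: "(\<Sum>l\<in>A. f l) i = (\<Sum>l\<in>A. f l i)" for f :: "'a \<Rightarrow> 'b \<Rightarrow> real"
  by (induction A rule: infinite_finite_induct) auto

lemma linear_apply_Rn:
  assumes "linear T" "x \<in> Rn n"
  shows "T x i = dot n (\<lambda>l. T (std_basis l) i) x"
proof -
  have "x = (\<Sum>l<n. x l *\<^sub>R std_basis l)"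
    using assms(2)
    by (auto simp: fun_eq_iff sum_fun_apply scaleR_fun_def std_basis_def Rn_iff if_distrib cong: if_cong)
  then have "T x = (\<Sum>l<n. x l *\<^sub>R T (std_basis l))"
    using assms(1) by (metis (no_types, lifting) linear_cmul linear_sum sum.cong)
  then show ?thesis
    by (simp add: sum_fun_apply scaleR_fun_def dot_def mult.commute)
qed

text \<open>
  Orthonormalising the rows \<open>t i\<close> of a matrix from the top downwards factors it as a lower
  triangular matrix with positive diagonal times one with orthonormal rows. The hypothesis says
  that the matrix maps onto \<open>Rn n\<close>; it is what keeps each new orthogonal residue nonzero.
\<close>

lemma Gram_Schmidt_rows:
  assumes onto: "\<And>i. i < n \<Longrightarrow> \<exists>x\<in>Rn n. \<forall>l<n. dot n (t l) x = std_basis i l" and "m \<le> n"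
  shows "\<exists>q R. (\<forall>a<m. \<forall>b<m. dot n (q a) (q b) = (if a = b then 1 else 0)) \<and>
    (\<forall>i<m. 0 < R i i \<and> (\<forall>j<n. t i j = (\<Sum>l\<le>i. R i l * q l j)))"
  using \<open>m \<le> n\<close>
proof (induction m)
  case 0
  show ?case by simp
next
  case (Suc m)
  from Suc.IH[OF Suc_leD[OF Suc.prems]]
  obtain q where "\<exists>R. (\<forall>a<m. \<forall>b<m. dot n (q a) (q b) = (if a = b then 1 else 0)) \<and>
    (\<forall>i<m. 0 < R i i \<and> (\<forall>j<n. t i j = (\<Sum>l\<le>i. R i l * q l j)))"
    by (rule exE)
  then obtain R where "(\<forall>a<m. \<forall>b<m. dot n (q a) (q b) = (if a = b then 1 else 0)) \<and>
    (\<forall>i<m. 0 < R i i \<and> (\<forall>j<n. t i j = (\<Sum>l\<le>i. R i l * q l j)))"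
    by (rule exE)
  then have q: "\<And>a b. a < m \<Longrightarrow> b < m \<Longrightarrow> dot n (q a) (q b) = (if a = b then 1 else 0)"
    and R: "\<And>i. i < m \<Longrightarrow> 0 < R i i" "\<And>i j. i < m \<Longrightarrow> j < n \<Longrightarrow> t i j = (\<Sum>l\<le>i. R i l * q l j)"
    by simp_all
  define r where "r l = dot n (t m) (q l)" for l
  define v where "v j = t m j - (\<Sum>l<m. r l * q l j)" for j
  define d where "d = sqrt (dot n v v)"
  have orth: "dot n v (q a) = 0" if "a < m" for a
  proof -
    have "dot n v (q a) = r a - (\<Sum>l<m. r l * dot n (q l) (q a))"
      by (simp add: v_def[abs_def] dot_diff dot_sum dot_scale r_def)
    also have "(\<Sum>l<m. r l * dot n (q l) (q a)) = (\<Sum>l<m. if l = a then r l else 0)"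
      using q that by (intro sum.cong) auto
    finally show ?thesis using that by simp
  qed
  have "dot n v v \<noteq> 0"
  proof
    assume v0: "dot n v v = 0"
    \<comment> \<open>A preimage of the \<open>m\<close>-th basis vector is orthogonal to all earlier rows, hence to their orthonormalisation, but not to row \<open>m\<close>; so row \<open>m\<close> is not in the span of the earlier ones.\<close>
    obtain x where x: "\<And>l. l < n \<Longrightarrow> dot n (t l) x = std_basis m l"
      using onto[of m] Suc.prems by auto
    have qx: "dot n (q i) x = 0" if "i < m" for i
      using that
    proof (induction i rule: less_induct)
      case (less i)
      have "0 = dot n (t i) x"
        using x[of i] less.prems Suc.prems by (simp add: std_basis_def)
      also have "\<dots> = dot n (\<lambda>j. \<Sum>l\<le>i. R i l * q l j) x"
        using R(2) less.prems by (simp add: dot_def)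
      also have "\<dots> = (\<Sum>l\<le>i. R i l * dot n (q l) x)"
        by (simp add: dot_sum dot_scale)
      also have "\<dots> = R i i * dot n (q i) x"
        using less by (simp add: lessThan_Suc_atMost[symmetric])
      finally show ?case using R(1)[OF less.prems] by simp
    qed
    have "dot n (t m) x = dot n (\<lambda>j. \<Sum>l<m. r l * q l j) x"
      using v0 by (simp add: dot_eq_0_iff v_def) (simp add: dot_def)
    also have "\<dots> = 0"
      using qx by (simp add: dot_sum dot_scale)
    finally show False
      using x[of m] Suc.prems by (simp add: std_basis_def)
  qed
  then have d: "d > 0" and dd: "d * d = dot n v v"
    using dot_nonneg[of n v] by (auto simp: d_def)
  define q' where "q' = q(m := \<lambda>j. v j / d)"
  define R' where "R' = R(m := r(m := d))"
  have q'm: "dot n (q' m) y = dot n v y / d" for y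
    using dot_scale[of n "1 / d" v y] by (simp add: q'_def)
  have orthonormal: "dot n (q' a) (q' b) = (if a = b then 1 else 0)" if "a < Suc m" "b < Suc m" for a b
  proof -
    have 1: "dot n (q' m) (q' m) = 1"
      using d q'm[of v] by (simp add: q'm dot_commute[of n v "q' m"] flip: dd)
    have 2: "dot n (q' m) (q' a) = 0" if "a < m" for a
      using orth[OF that] that by (subst q'm) (simp add: q'_def)
    have 3: "dot n (q' a) (q' b) = (if a = b then 1 else 0)" if "a < m" "b < m" for a b
      using q that by (simp add: q'_def)
    show ?thesis
      using that 1 2 3 dot_commute[of n "q' a" "q' m"] by (cases "a = m"; cases "b = m") auto
  qed
  have factor: "0 < R' i i \<and> (\<forall>j<n. t i j = (\<Sum>l\<le>i. R' i l * q' l j))" if i: "i < Suc m" for i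
  proof (cases "i = m")
    case True
    have "(\<Sum>l<m. R' m l * q' l j) = (\<Sum>l<m. r l * q l j)" for j
      by (intro sum.cong) (auto simp: R'_def q'_def)
    then show ?thesis
      using True d by (simp add: lessThan_Suc_atMost[symmetric] v_def R'_def q'_def)
  next
    case False
    then have "i < m" using i by simp
    moreover have "(\<Sum>l\<le>i. R' i l * q' l j) = (\<Sum>l\<le>i. R i l * q l j)" for j
      using \<open>i < m\<close> by (intro sum.cong) (auto simp: R'_def q'_def)
    ultimately show ?thesis
      using R by (simp add: R'_def)
  qed
  show ?case
    by (rule exI[of _ q'], rule exI[of _ R'], intro conjI allI impI)
      (use orthonormal factor in simp_all)
qed

text \<open>
  The transpose \<open>p\<close> is an isometric right inverse of the map, which gives one inclusion without
  knowing that the columns are orthonormal as well. The other is Bessel's inequality.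
\<close>

lemma orthonormal_rows_image_unit_ball:
  assumes q: "\<And>a b. a < n \<Longrightarrow> b < n \<Longrightarrow> dot n (q a) (q b) = (if a = b then 1 else 0)"
  shows "(\<lambda>x i. if i < n then dot n (q i) x else 0) ` unit_ball n = unit_ball n" (is "?q ` _ = _")
proof -
  define p where "p y = (\<lambda>j. if j < n then \<Sum>a<n. y a * q a j else 0)" for y :: "nat \<Rightarrow> real"
  have p: "dot n (p y) x = dot n y (?q x)" for y x
  proof -
    have "dot n (p y) x = dot n (\<lambda>j. \<Sum>a<n. y a * q a j) x"
      by (simp add: p_def dot_def)
    also have "\<dots> = dot n y (?q x)"
      by (simp only: dot_sum dot_scale) (simp add: dot_def)
    finally show ?thesis .
  qed
  have qp: "?q (p y) i = y i" if "i < n" for y i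
  proof -
    have "?q (p y) i = dot n y (?q (q i))"
      using that p[of y "q i"] by (simp add: dot_commute)
    also have "\<dots> = (\<Sum>a<n. if a = i then y a else 0)"
      unfolding dot_def[of n y] using q that by (intro sum.cong) auto
    finally show ?thesis using that by simp
  qed
  have pp: "dot n (p y) (p y) = dot n y y" for y
  proof -
    have "dot n y (?q (p y)) = dot n y y"
      unfolding dot_def[of n y] using qp[of _ y] by (intro sum.cong) auto
    then show ?thesis by (simp only: p)
  qed
  show ?thesis
  proof (intro equalityI subsetI)
    fix z assume "z \<in> ?q ` unit_ball n"
    then obtain x where x: "x \<in> unit_ball n" and z: "z = ?q x" by auto
    have "dot n (p z) x = dot n z z"
      unfolding p z ..
    then have "0 \<le> dot n x x - dot n z z"
      using dot_nonneg[of n "\<lambda>i. x i - p z i"] dot_commute[of n x "p z"]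
      by (simp add: dot_square_diff pp)
    then show "z \<in> unit_ball n"
      using x by (simp add: unit_ball_iff z Rn_iff)
  next
    fix y assume y: "y \<in> unit_ball n"
    have "y = ?q (p y)"
      using y qp by (auto simp: fun_eq_iff unit_ball_iff Rn_iff)
    moreover have "p y \<in> unit_ball n"
      using y by (simp add: unit_ball_iff pp) (simp add: Rn_iff p_def)
    ultimately show "y \<in> ?q ` unit_ball n" by blast
  qed
qed

text \<open>
  The orthogonal factor of a matrix leaves the ball invariant, so in every ellipsoid the linear
  map can be replaced by its triangular factor. This avoids determinants and the positive
  definite square root that the classical treatment uses.
\<close>

lemma ellipsoid_lower_affine:
  assumes "ellipsoid n E"
  obtains c R where "\<And>i. i < n \<Longrightarrow> 0 < R i i" "E = lower_affine n c R ` unit_ball n"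
proof -
  obtain c T where c: "c \<in> Rn n" and T: "linear T" "T ` Rn n = Rn n"
    and E: "E = (\<lambda>x. c + T x) ` unit_ball n"
    using assms unfolding ellipsoid_def by blast
  define t where "t i l = T (std_basis l) i" for i l
  have Tx: "T x i = dot n (t i) x" if "x \<in> Rn n" for x i
    using linear_apply_Rn[OF T(1) that, of i] by (simp add: t_def[abs_def])
  have "\<exists>x\<in>Rn n. \<forall>l<n. dot n (t l) x = std_basis i l" if "i < n" for i
  proof -
    have "std_basis i \<in> T ` Rn n"
      unfolding T(2) using that by (auto simp: Rn_iff std_basis_def)
    then show ?thesis using Tx by force
  qed
  from Gram_Schmidt_rows[OF this order_refl]
  obtain q where "\<exists>R. (\<forall>a<n. \<forall>b<n. dot n (q a) (q b) = (if a = b then 1 else 0)) \<and>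
    (\<forall>i<n. 0 < R i i \<and> (\<forall>j<n. t i j = (\<Sum>l\<le>i. R i l * q l j)))"
    by (rule exE)
  then obtain R where "(\<forall>a<n. \<forall>b<n. dot n (q a) (q b) = (if a = b then 1 else 0)) \<and>
    (\<forall>i<n. 0 < R i i \<and> (\<forall>j<n. t i j = (\<Sum>l\<le>i. R i l * q l j)))"
    by (rule exE)
  then have q: "\<And>a b. a < n \<Longrightarrow> b < n \<Longrightarrow> dot n (q a) (q b) = (if a = b then 1 else 0)"
    and R: "\<And>i. i < n \<Longrightarrow> 0 < R i i" "\<And>i j. i < n \<Longrightarrow> j < n \<Longrightarrow> t i j = (\<Sum>l\<le>i. R i l * q l j)"
    by simp_all
  let ?q = "\<lambda>x i. if i < n then dot n (q i) x else 0"
  have "(\<lambda>x. c + T x) x = lower_affine n c R (?q x)" if "x \<in> unit_ball n" for x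
  proof
    fix i
    have x: "x \<in> Rn n" using that by (simp add: unit_ball_iff)
    show "(c + T x) i = lower_affine n c R (?q x) i"
    proof (cases "i < n")
      case True
      have "dot n (t i) x = dot n (\<lambda>j. \<Sum>l\<le>i. R i l * q l j) x"
        using R(2) True by (simp add: dot_def)
      also have "\<dots> = (\<Sum>l\<le>i. R i l * dot n (q l) x)"
        by (simp add: dot_sum dot_scale)
      also have "\<dots> = (\<Sum>l\<le>i. R i l * ?q x l)"
        using True by (intro sum.cong) auto
      finally show ?thesis
        using True Tx[OF x, of i] by (simp add: lower_affine_def)
    next
      case False
      moreover have "T x \<in> Rn n" using T(2) x by blast
      ultimately show ?thesis
        using c by (simp add: lower_affine_def Rn_iff)
    qed
  qed
  then have "E = lower_affine n c R ` ?q ` unit_ball n"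
    unfolding E image_image by (intro image_cong) auto
  also have "?q ` unit_ball n = unit_ball n"
    by (rule orthonormal_rows_image_unit_ball) (rule q)
  finally show thesis using that R(1) by blast
qed

lemma ellipsoid_unit_ball: "ellipsoid n (unit_ball n)"
  unfolding ellipsoid_def
  by (rule exI[of _ 0], rule exI[of _ id]) (simp add: Rn_iff linear_id[unfolded id_def] id_def)

lemma vol_ellipsoid:
  assumes "\<And>i. i < n \<Longrightarrow> 0 < R i i"
  shows "vol n (lower_affine n c R ` unit_ball n) = (\<Prod>i<n. R i i) * vol n (unit_ball n)"
  by (rule vol_lower_affine) (use assms compact_unit_ball in \<open>auto simp: unit_ball_iff\<close>)

section \<open>John's criterion for symmetric bodies\<close>

lemma sum_triangle_swap:
  fixes f :: "nat \<Rightarrow> nat \<Rightarrow> real"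
  shows "(\<Sum>a<n. \<Sum>l\<le>a. f a l) = (\<Sum>l<n. \<Sum>a=l..<n. f a l)"
  by (induction n) (simp_all add: sum.distrib flip: lessThan_Suc_atMost)

definition symmetric_body :: "nat \<Rightarrow> 'a set \<Rightarrow> ('a \<Rightarrow> nat \<Rightarrow> real) \<Rightarrow> (nat \<Rightarrow> real) set" where
  "symmetric_body n I u = {x \<in> Rn n. \<forall>i\<in>I. \<bar>dot n (u i) x\<bar> \<le> 1}"

text \<open>
  John's decomposition of the identity, \<open>\<Sum>\<^sub>i w\<^sub>i u\<^sub>i \<otimes> u\<^sub>i = 1\<close>, for unit vectors. The bodies cut
  out by them are symmetric, so that \<open>u\<^sub>i\<close> stands for both \<open>u\<^sub>i\<close> and \<open>- u\<^sub>i\<close>, and the usual centring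
  condition \<open>\<Sum>\<^sub>i w\<^sub>i u\<^sub>i = 0\<close> holds for the doubled system automatically.
\<close>

locale john_decomposition =
  fixes n :: nat and I :: "'a set" and u :: "'a \<Rightarrow> nat \<Rightarrow> real" and w :: "'a \<Rightarrow> real"
  assumes finite_I: "finite I"
    and unit: "i \<in> I \<Longrightarrow> dot n (u i) (u i) = 1"
    and weight_pos: "i \<in> I \<Longrightarrow> 0 < w i"
    and decomposition: "a < n \<Longrightarrow> b < n \<Longrightarrow> (\<Sum>i\<in>I. w i * u i a * u i b) = (if a = b then 1 else 0)"
begin

text \<open>
  Both sides are the trace of the decomposition.
\<close>

lemma sum_weights: "(\<Sum>i\<in>I. w i) = real n"
proof -
  have "(\<Sum>i\<in>I. w i) = (\<Sum>i\<in>I. \<Sum>a<n. w i * u i a * u i a)"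
    using unit by (intro sum.cong) (auto simp: dot_def sum_distrib_left[symmetric] mult.assoc)
  also have "\<dots> = (\<Sum>a<n. \<Sum>i\<in>I. w i * u i a * u i a)"
    by (rule sum.swap)
  also have "\<dots> = real n"
    using decomposition by simp
  finally show ?thesis .
qed

lemma sum_weighted_dot:
  assumes "a < n"
  shows "(\<Sum>i\<in>I. w i * u i a * dot n (u i) x) = x a"
proof -
  have "(\<Sum>i\<in>I. w i * u i a * dot n (u i) x) = (\<Sum>i\<in>I. \<Sum>b<n. w i * u i a * u i b * x b)"
    by (simp add: dot_def sum_distrib_left mult.assoc)
  also have "\<dots> = (\<Sum>b<n. (\<Sum>i\<in>I. w i * u i a * u i b) * x b)"
    by (subst sum.swap) (simp add: sum_distrib_right)
  also have "\<dots> = (\<Sum>b<n. if a = b then x b else 0)"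
    using decomposition assms by (intro sum.cong) auto
  finally show ?thesis using assms by simp
qed

lemma dot_self_eq: "dot n x x = (\<Sum>i\<in>I. w i * (dot n (u i) x)\<^sup>2)"
proof -
  have "dot n x x = (\<Sum>a<n. \<Sum>i\<in>I. x a * (w i * u i a * dot n (u i) x))"
    by (subst dot_def) (intro sum.cong refl, simp add: sum_weighted_dot flip: sum_distrib_left)
  also have "\<dots> = (\<Sum>i\<in>I. \<Sum>a<n. (w i * dot n (u i) x) * (u i a * x a))"
    by (subst sum.swap) (simp add: mult_ac)
  also have "\<dots> = (\<Sum>i\<in>I. w i * (dot n (u i) x)\<^sup>2)"
    unfolding sum_distrib_left[symmetric] dot_def[of n "u _" x, symmetric]
    by (simp add: power2_eq_square mult.assoc)
  finally show ?thesis .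
qed

lemma unit_ball_subset: "unit_ball n \<subseteq> symmetric_body n I u"
  using abs_dot_le_1 unit by (fastforce simp: unit_ball_iff symmetric_body_def)

lemma symmetric_body_bounded:
  assumes "x \<in> symmetric_body n I u"
  shows "dot n x x \<le> real n"
proof -
  have "dot n x x \<le> (\<Sum>i\<in>I. w i * 1)"
    unfolding dot_self_eq
  proof (intro sum_mono mult_left_mono)
    fix i assume i: "i \<in> I"
    show "(dot n (u i) x)\<^sup>2 \<le> 1"
      using assms i by (simp add: symmetric_body_def abs_square_le_1)
    show "0 \<le> w i" using weight_pos[OF i] by simp
  qed
  then show ?thesis by (simp add: sum_weights)
qed

lemma convex_body_symmetric_body: "convex_body n (symmetric_body n I u)"
proof -
  let ?L = "symmetric_body n I u"
  have dot_lin: "dot n v (a *\<^sub>R x + b *\<^sub>R y) = a * dot n v x + b * dot n v y" for v x y a b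
    by (simp add: dot_def scaleR_fun_def distrib_left sum.distrib sum_distrib_left mult_ac)
  have "convex ?L"
  proof (rule convexI)
    fix x y and a b :: real
    assume xy: "x \<in> ?L" "y \<in> ?L" and ab: "0 \<le> a" "0 \<le> b" "a + b = 1"
    have "\<bar>dot n (u i) (a *\<^sub>R x + b *\<^sub>R y)\<bar> \<le> 1" if "i \<in> I" for i
    proof -
      have "\<bar>a * dot n (u i) x + b * dot n (u i) y\<bar> \<le> a * \<bar>dot n (u i) x\<bar> + b * \<bar>dot n (u i) y\<bar>"
        using ab abs_triangle_ineq[of "a * dot n (u i) x" "b * dot n (u i) y"] by (simp add: abs_mult)
      also have "\<dots> \<le> a * 1 + b * 1"
        using xy ab that by (intro add_mono mult_left_mono) (auto simp: symmetric_body_def)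
      finally show ?thesis using ab by (simp add: dot_lin)
    qed
    then show "a *\<^sub>R x + b *\<^sub>R y \<in> ?L"
      using xy by (simp add: symmetric_body_def Rn_iff scaleR_fun_def)
  qed
  moreover have "compactin (Euclidean_space n) ?L"
  proof -
    let ?A = "\<Inter>i\<in>I. {x. \<bar>dot n (u i) x\<bar> \<le> 1}"
    have L: "?L = ?A \<inter> Rn n"
      by (auto simp: symmetric_body_def)
    have "closed ?A"
      by (intro closed_INT ballI closed_Collect_le continuous_intros continuous_dot)
    moreover have "\<bar>x i\<bar> \<le> sqrt (real n)" if "x \<in> ?A \<inter> Rn n" "i < n" for x i
      using symmetric_body_bounded[of x] coord_le_dot[OF that(2), of x] that(1) L
      by (intro real_le_rsqrt) (auto intro: order_trans)
    ultimately have "compact ?L"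
      unfolding L by (rule compact_Rn)
    then show ?thesis
      by (simp add: compactin_Euclidean_space symmetric_body_def)
  qed
  moreover have "Euclidean_space n interior_of ?L \<noteq> {}"
  proof -
    let ?U = "\<Inter>i\<in>I. {x. \<bar>dot n (u i) x\<bar> < 1}"
    have "open ?U"
      using finite_I by (intro open_INT ballI open_Collect_less continuous_intros continuous_dot)
    then have "openin (Euclidean_space n) (Rn n \<inter> ?U)"
      by (subst Euclidean_space_eq_subtopology) (auto simp: openin_subtopology)
    moreover have "Rn n \<inter> ?U \<subseteq> ?L"
      by (auto simp: symmetric_body_def intro: less_imp_le)
    moreover have "(\<lambda>_. 0) \<in> Rn n \<inter> ?U"
      by (simp add: Rn_iff dot_def)
    ultimately show ?thesis
      using interior_of_maximal by blast
  qed
  ultimately show ?thesis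
    by (simp add: convex_body_def)
qed

text \<open>
  Testing the ellipsoid at the points \<open>c \<plusminus> R u\<^sub>i\<close> gives
  \<open>\<bar>\<langle>u\<^sub>i, c\<rangle>\<bar> + \<bar>\<langle>u\<^sub>i, R u\<^sub>i\<rangle>\<bar> \<le> 1\<close>. Averaged with the weights, the second terms give the trace of
  \<open>R\<close>, so the trace is at most \<open>n\<close>, and \<open>x \<le> exp (x - 1)\<close> on the diagonal turns this into a bound
  on the product. If the product is 1, then no loss occurs at any \<open>i\<close>: the centre is orthogonal
  to all \<open>u\<^sub>i\<close>, and the transpose of \<open>R\<close>, which maps \<open>u\<^sub>i\<close> to a vector of length at most 1 having
  inner product 1 with \<open>u\<^sub>i\<close>, fixes \<open>u\<^sub>i\<close>. As the \<open>u\<^sub>i\<close> span, \<open>R\<close> is the identity and \<open>c\<close> is 0.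
\<close>

lemma contained_ellipsoid:
  assumes R: "\<And>i. i < n \<Longrightarrow> 0 < R i i"
    and sub: "lower_affine n c R ` unit_ball n \<subseteq> symmetric_body n I u"
  shows "(\<Prod>i<n. R i i) \<le> 1"
    and "(\<Prod>i<n. R i i) = 1 \<Longrightarrow> lower_affine n c R ` unit_ball n = unit_ball n"
proof -
  \<comment> \<open>The transpose of \<open>R\<close>, of which only the entries on and below the diagonal count.\<close>
  define S where "S v b = (if b < n then \<Sum>a = b..<n. v a * R a b else 0)" for v b
  have dot_affine: "dot n v (lower_affine n c R x) = dot n v c + dot n (S v) x" for v x
  proof -
    have "(\<Sum>a<n. \<Sum>l\<le>a. v a * (R a l * x l)) = (\<Sum>l<n. \<Sum>a=l..<n. v a * (R a l * x l))"
      by (rule sum_triangle_swap)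
    then show ?thesis
      by (simp add: dot_def lower_affine_def distrib_left sum.distrib sum_distrib_left
          sum_distrib_right S_def mult.assoc)
  qed
  define r where "r i = dot n (S (u i)) (u i)" for i
  have bound: "\<bar>dot n (u i) c + dot n (S (u i)) x\<bar> \<le> 1" if "i \<in> I" "x \<in> unit_ball n" for i x
    using sub that dot_affine[of "u i" x] by (force simp: symmetric_body_def)
  \<comment> \<open>Points of \<open>unit_ball n\<close> vanish from coordinate \<open>n\<close> on, which the \<open>u i\<close> need not do.\<close>
  define cut where "cut v = (\<lambda>j. if j < n then v j else 0)" for v :: "nat \<Rightarrow> real"
  have dot_cut [simp]: "dot n v (cut x) = dot n v x" "dot n (cut x) v = dot n x v" for v x
    by (simp_all add: dot_def cut_def)
  have cut_ball: "cut x \<in> unit_ball n" if "dot n x x \<le> 1" for x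
    using that by (simp add: unit_ball_iff) (simp add: cut_def Rn_iff)
  have two_sided: "\<bar>dot n (u i) c\<bar> + \<bar>dot n (S (u i)) x\<bar> \<le> 1" if "i \<in> I" "dot n x x \<le> 1" for i x
  proof -
    have "dot n (\<lambda>j. - x j) (\<lambda>j. - x j) \<le> 1" using that by (simp add: dot_def)
    moreover have "dot n v (\<lambda>j. - x j) = - dot n v x" for v by (simp add: dot_def sum_negf)
    ultimately show ?thesis
      using bound[OF that(1) cut_ball[OF that(2)]] bound[OF that(1) cut_ball, of "\<lambda>j. - x j"]
      by simp
  qed
  have r_le: "r i \<le> 1" if "i \<in> I" for i
    using two_sided[of i "u i"] unit that by (simp add: r_def)
  have trace: "(\<Sum>i\<in>I. w i * r i) = (\<Sum>b<n. R b b)"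
  proof -
    have "(\<Sum>i\<in>I. w i * r i) = (\<Sum>i\<in>I. \<Sum>b<n. \<Sum>a=b..<n. w i * u i a * u i b * R a b)"
      by (simp add: r_def dot_def S_def sum_distrib_left sum_distrib_right mult_ac)
    also have "\<dots> = (\<Sum>b<n. \<Sum>a=b..<n. \<Sum>i\<in>I. w i * u i a * u i b * R a b)"
      by (subst sum.swap, intro sum.cong refl, rule sum.swap)
    also have "\<dots> = (\<Sum>b<n. \<Sum>a=b..<n. if a = b then R a b else 0)"
      using decomposition by (intro sum.cong refl) (auto simp flip: sum_distrib_right)
    also have "\<dots> = (\<Sum>b<n. R b b)"
      by (intro sum.cong refl) auto
    finally show ?thesis .
  qed
  have "(\<Prod>b<n. R b b) \<le> (\<Prod>b<n. exp (R b b - 1))"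
  proof (rule prod_mono)
    fix b assume "b \<in> {..<n}"
    then show "0 \<le> R b b \<and> R b b \<le> exp (R b b - 1)"
      using R[of b] exp_ge_add_one_self[of "R b b - 1"] by simp
  qed
  also have "\<dots> = exp ((\<Sum>b<n. R b b) - real n)"
    by (simp add: sum_subtractf flip: exp_sum)
  also have "(\<Sum>b<n. R b b) - real n = - (\<Sum>i\<in>I. w i * (1 - r i))"
    by (simp add: trace[symmetric] sum_weights[symmetric] sum_subtractf algebra_simps)
  finally have prod_le: "(\<Prod>b<n. R b b) \<le> exp (- (\<Sum>i\<in>I. w i * (1 - r i)))" .
  have defect: "0 \<le> w i * (1 - r i)" if "i \<in> I" for i
    using weight_pos r_le that by (simp add: less_imp_le)
  then have "0 \<le> (\<Sum>i\<in>I. w i * (1 - r i))"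
    by (rule sum_nonneg)
  with prod_le show "(\<Prod>i<n. R i i) \<le> 1"
    by (meson exp_le_one_iff neg_le_0_iff_le order_trans)
  show "lower_affine n c R ` unit_ball n = unit_ball n" if eq: "(\<Prod>i<n. R i i) = 1"
  proof -
    have "(\<Sum>i\<in>I. w i * (1 - r i)) \<le> 0"
      using prod_le eq by simp
    then have "(\<Sum>i\<in>I. w i * (1 - r i)) = 0"
      using \<open>0 \<le> (\<Sum>i\<in>I. w i * (1 - r i))\<close> by simp
    then have r1: "r i = 1" if "i \<in> I" for i
      using that finite_I defect weight_pos by (fastforce simp: sum_nonneg_eq_0_iff)
    have c: "dot n (u i) c = 0" if "i \<in> I" for i
      using two_sided[of i "u i"] unit r1 that by (simp add: r_def)
    have S: "S (u i) b = u i b" if "i \<in> I" "b < n" for i b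
    proof -
      let ?s = "S (u i)"
      have "dot n ?s ?s \<le> 1"
      proof (rule ccontr)
        assume "\<not> dot n ?s ?s \<le> 1"
        then have d: "1 < dot n ?s ?s" by simp
        \<comment> \<open>The transposed image, normalised, is the test point where its own length is attained.\<close>
        define e where "e = sqrt (dot n ?s ?s)"
        have e: "1 < e" "e * e = dot n ?s ?s" using d by (auto simp: e_def)
        have "dot n (\<lambda>j. (1 / e) * ?s j) (\<lambda>j. (1 / e) * ?s j) = 1"
          using e by (simp only: dot_scale dot_commute[of n ?s "\<lambda>j. (1 / e) * ?s j"]) (simp flip: e(2))
        from two_sided[OF that(1), of "\<lambda>j. (1 / e) * ?s j"] this
        have "\<bar>dot n ?s (\<lambda>j. (1 / e) * ?s j)\<bar> \<le> 1" by linarith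
        then have "\<bar>1 / e * (e * e)\<bar> \<le> 1"
          by (simp only: dot_commute[of n ?s "\<lambda>j. (1 / e) * ?s j"] dot_scale e)
        moreover have "1 / e * (e * e) = e" using e(1) by simp
        ultimately show False using e(1) by linarith
      qed
      then have "dot n (\<lambda>j. ?s j - u i j) (\<lambda>j. ?s j - u i j) \<le> 0"
        using r1[OF that(1)] unit[OF that(1)] by (simp add: dot_square_diff r_def)
      then have "dot n (\<lambda>j. ?s j - u i j) (\<lambda>j. ?s j - u i j) = 0"
        using dot_nonneg by (rule antisym)
      then show ?thesis using that(2) by (simp add: dot_eq_0_iff)
    qed
    have "lower_affine n c R x = x" if x: "x \<in> unit_ball n" for x
    proof
      fix a
      show "lower_affine n c R x a = x a"
      proof (cases "a < n")
        case True
        have "dot n (S (u i)) x = dot n (u i) x" if "i \<in> I" for i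
          using S that by (simp add: dot_def)
        then have "dot n (u i) (lower_affine n c R x) = dot n (u i) x" if "i \<in> I" for i
          using c that by (simp add: dot_affine)
        then have "(\<Sum>i\<in>I. w i * u i a * dot n (u i) (lower_affine n c R x)) = (\<Sum>i\<in>I. w i * u i a * dot n (u i) x)"
          by simp
        then show ?thesis by (simp only: sum_weighted_dot[OF True])
      next
        case False
        then show ?thesis using x by (simp add: lower_affine_def unit_ball_iff Rn_iff)
      qed
    qed
    then show ?thesis by simp
  qed
qed

lemma john_position_symmetric_body: "john_position n (symmetric_body n I u)"
proof -
  let ?L = "symmetric_body n I u" and ?B = "unit_ball n"
  have le: "vol n E \<le> vol n ?B" and eq: "vol n E = vol n ?B \<Longrightarrow> E = ?B"
    if E: "ellipsoid n E" "E \<subseteq> ?L" for E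
  proof -
    obtain c R where R: "\<And>i. i < n \<Longrightarrow> 0 < R i i" and ER: "E = lower_affine n c R ` ?B"
      by (rule ellipsoid_lower_affine[OF E(1)]) blast
    have vol: "vol n E = (\<Prod>i<n. R i i) * vol n ?B"
      unfolding ER by (rule vol_ellipsoid[OF R])
    have sub: "lower_affine n c R ` ?B \<subseteq> ?L" using E(2) ER by simp
    show "vol n E \<le> vol n ?B"
      using contained_ellipsoid(1)[OF R sub] vol_unit_ball_pos[of n] by (simp add: vol mult_le_cancel_right1)
    show "E = ?B" if "vol n E = vol n ?B"
      using contained_ellipsoid(2)[OF R sub] vol_unit_ball_pos[of n] that vol ER by simp
  qed
  show ?thesis
    unfolding john_position_def max_volume_ellipsoid_def
    using le eq ellipsoid_unit_ball[of n] unit_ball_subset by (metis order_antisym)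
qed

end

section \<open>Hadamard contact points\<close>

text \<open>
  Sylvester's Hadamard matrices with orthogonal columns. Doubling is done on the lowest binary
  digit of the indices, so that an index pair reduces to its halves.
\<close>

lemma Ex_Hadamard:
  "\<exists>h :: nat \<Rightarrow> nat \<Rightarrow> real. (\<forall>i j. (h i j)\<^sup>2 = 1) \<and>
     (\<forall>a<2^m. \<forall>b<2^m. (\<Sum>i<2^m. h i a * h i b) = (if a = b then 2^m else 0))"
proof (induction m)
  case 0
  show ?case by (rule exI[of _ "\<lambda>_ _. 1"]) simp
next
  case (Suc m)
  then obtain h :: "nat \<Rightarrow> nat \<Rightarrow> real" where h: "\<And>i j. (h i j)\<^sup>2 = 1"
    "\<And>a b. a < 2^m \<Longrightarrow> b < 2^m \<Longrightarrow> (\<Sum>i<2^m. h i a * h i b) = (if a = b then 2^m else 0)"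
    by blast
  define g where "g i j = (if odd i \<and> odd j then -1 else 1) * h (i div 2) (j div 2)" for i j
  have "(\<Sum>i<2^Suc m. g i a * g i b) = (if a = b then 2^Suc m else 0)"
    if ab: "a < 2^Suc m" "b < 2^Suc m" for a b
  proof -
    let ?s = "1 + (if odd a then -1 else 1) * (if odd b then -1 else 1) :: real"
    have split: "(\<Sum>i<2*N. g i a * g i b) = ?s * (\<Sum>i<N. h i (a div 2) * h i (b div 2))" for N
      by (induction N) (auto simp: g_def algebra_simps)
    have "a = b \<longleftrightarrow> a div 2 = b div 2 \<and> (odd a \<longleftrightarrow> odd b)"
      by presburger
    moreover have "a div 2 < 2^m" "b div 2 < 2^m" using ab by auto
    ultimately show ?thesis
      using split[of "2^m"] h(2)[of "a div 2" "b div 2"] by auto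
  qed
  moreover have "(g i j)\<^sup>2 = 1" for i j
    by (simp add: g_def h(1) power_mult_distrib)
  ultimately show ?case by blast
qed

text \<open>
  The first \<open>k\<close> coordinates of the contact point \<open>(i, s)\<close> are those of a multiple of the basis
  vector \<open>i\<close>, and the last \<open>n - k\<close> are \<open>s / sqrt n\<close> times the beginning of row \<open>i\<close> of the sign matrix
  \<open>h\<close>. The two blocks contribute \<open>k / n\<close> and \<open>(n - k) / n\<close> to the squared norm.
\<close>

definition contact_point :: "(nat \<Rightarrow> nat \<Rightarrow> real) \<Rightarrow> nat \<Rightarrow> nat \<Rightarrow> nat \<times> real \<Rightarrow> nat \<Rightarrow> real" where
  "contact_point h k n = (\<lambda>(i, s) j.
     if j < k then (if j = i then sqrt (real k / real n) else 0) else s * h i (j - k) / sqrt (real n))"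

lemma sum_split_at:
  fixes f :: "nat \<Rightarrow> 'b :: comm_monoid_add"
  assumes "k \<le> n"
  shows "(\<Sum>j<n. f j) = (\<Sum>j<k. f j) + (\<Sum>j=k..<n. f j)"
  using sum.atLeastLessThan_concat[of 0 k n f] assms by (simp add: atLeast0LessThan)

text \<open>
  In the decomposition, the diagonal blocks come out right since the basis vectors and the
  columns of \<open>h\<close> are orthogonal, and the mixed block cancels between the signs \<open>s\<close>. There are only
  \<open>k\<close> columns, hence the bound on \<open>n - k\<close>.
\<close>

lemma john_decomposition_contact_point:
  assumes k: "0 < k" "k < n" "n < 2 * k"
    and sign: "\<And>i j. (h i j)\<^sup>2 = 1"
    and orth: "\<And>a b. a < k \<Longrightarrow> b < k \<Longrightarrow> (\<Sum>i<k. h i a * h i b) = (if a = b then real k else 0)"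
  shows "john_decomposition n ({..<k} \<times> {1, -1}) (contact_point h k n) (\<lambda>_. real n / (2 * real k))"
proof
  let ?u = "contact_point h k n" and ?w = "real n / (2 * real k)"
  have n: "0 < real n" using k by simp
  show "finite ({..<k} \<times> {1, - 1 :: real})" by simp
  show "0 < ?w" using k by simp
  show "dot n (?u p) (?u p) = 1" if p: "p \<in> {..<k} \<times> {1, -1}" for p
  proof -
    obtain i s where p: "p = (i, s)" "i < k" "s * s = 1" using p by auto
    have "(\<Sum>j<k. ?u p j * ?u p j) = (\<Sum>j<k. if j = i then real k / real n else 0)"
      by (intro sum.cong) (auto simp: contact_point_def p)
    moreover have "(\<Sum>j=k..<n. ?u p j * ?u p j) = (\<Sum>j=k..<n. 1 / real n)"
    proof (intro sum.cong refl)
      fix j assume "j \<in> {k..<n}"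
      then have "?u p j * ?u p j = (s * s) * (h i (j - k))\<^sup>2 / (sqrt (real n) * sqrt (real n))"
        by (simp add: contact_point_def p power2_eq_square)
      then show "?u p j * ?u p j = 1 / real n"
        by (simp only: p sign) simp
    qed
    ultimately show ?thesis
      using k p n by (simp add: dot_def sum_split_at[of k n] of_nat_diff flip: add_divide_distrib)
  qed
  show "(\<Sum>p\<in>{..<k} \<times> {1, -1}. ?w * ?u p a * ?u p b) = (if a = b then 1 else 0)"
    if ab: "a < n" "b < n" for a b
  proof -
    have sum: "(\<Sum>p\<in>{..<k} \<times> {1, -1}. ?w * ?u p a * ?u p b)
        = ?w * (\<Sum>i<k. ?u (i, 1) a * ?u (i, 1) b + ?u (i, -1) a * ?u (i, -1) b)"
      by (simp add: sum.cartesian_product' sum_distrib_left algebra_simps)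
    consider "a < k" "b < k" | "a < k" "k \<le> b" | "k \<le> a" "b < k" | "k \<le> a" "k \<le> b"
      by linarith
    then show ?thesis
    proof cases
      case 1
      have "(\<Sum>i<k. ?u (i, 1) a * ?u (i, 1) b + ?u (i, -1) a * ?u (i, -1) b)
          = (\<Sum>i<k. if i = a then (if a = b then 2 * (real k / real n) else 0) else 0)"
        using 1 by (intro sum.cong) (auto simp: contact_point_def)
      then show ?thesis using 1 k n unfolding sum by simp
    next
      case 2
      then show ?thesis unfolding sum by (simp add: contact_point_def)
    next
      case 3
      then show ?thesis unfolding sum by (simp add: contact_point_def)
    next
      case 4
      have "(\<Sum>i<k. ?u (i, 1) a * ?u (i, 1) b + ?u (i, -1) a * ?u (i, -1) b)
          = (\<Sum>i<k. (2 / real n) * (h i (a - k) * h i (b - k)))"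
        using 4 by (intro sum.cong) (auto simp: contact_point_def)
      also have "\<dots> = (2 / real n) * (if a = b then real k else 0)"
        using 4 ab k by (subst sum_distrib_left[symmetric], subst orth) auto
      finally show ?thesis using k n unfolding sum by simp
    qed
  qed
qed

text \<open>
  A vector of \<open>Rn k\<close> sees only the first block of a contact point, so the section is a cube whose
  size is the reciprocal of the coefficient of that block.
\<close>

lemma contact_body_section:
  assumes k: "0 < k" "k < n"
  shows "symmetric_body n ({..<k} \<times> {1, -1}) (contact_point h k n) \<inter> Rn k
    = {x \<in> Rn k. \<forall>i<k. \<bar>x i\<bar> \<le> sqrt (real n / real k)}"
proof -
  have dot: "dot n (contact_point h k n (i, s)) x = sqrt (real k / real n) * x i"
    if "x \<in> Rn k" "i < k" for x i s
  proof -
    have "dot n (contact_point h k n (i, s)) x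
        = (\<Sum>j<n. if j = i then sqrt (real k / real n) * x j else 0)"
      unfolding dot_def using that by (intro sum.cong) (auto simp: contact_point_def Rn_iff)
    then show ?thesis using that k by simp
  qed
  have le: "\<bar>sqrt (real k / real n) * t\<bar> \<le> 1 \<longleftrightarrow> \<bar>t\<bar> \<le> sqrt (real n / real k)" for t
    using k by (simp add: abs_mult real_sqrt_divide field_simps)
  have "x \<in> Rn n" if "x \<in> Rn k" for x
    using that k by (simp add: Rn_iff)
  then show ?thesis
    using dot le by (auto simp: symmetric_body_def)
qed

text \<open>
  Strict concavity of \<open>ln\<close> on \<open>{1..2}\<close>: the average slope of \<open>ln\<close> is at least \<open>1 / t\<close> to the left of \<open>t\<close>,
  and less than \<open>1 / t\<close> to the right.
\<close>

lemma two_powr_less: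
  assumes "1 < t" "t < (2::real)"
  shows "2 powr (t - 1) < t"
proof -
  have "(t - 1) / t \<le> ln t"
    using ln_le_minus_one[of "1 / t"] assms by (simp add: ln_div field_simps)
  then have 1: "(2 - t) * ((t - 1) / t) \<le> (2 - t) * ln t"
    using assms by (intro mult_left_mono) auto
  have "ln 2 - ln t < (2 - t) / t"
    using ln_add_one_self_less_self[of "2 / t - 1"] assms by (simp add: ln_div diff_divide_distrib)
  then have "(t - 1) * (ln 2 - ln t) < (t - 1) * ((2 - t) / t)"
    using assms by (intro mult_strict_left_mono) auto
  also have "\<dots> = (2 - t) * ((t - 1) / t)" by simp
  finally have "(t - 1) * ln 2 < ln t"
    using 1 by (simp add: algebra_simps)
  then have "exp ((t - 1) * ln 2) < exp (ln t)" by simp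
  then show ?thesis using assms by (simp add: powr_def)
qed

section \<open>Sections of large volume\<close>

theorem theorem8:
  shows "\<forall>K::nat. \<exists>k\<ge>K. \<forall>n::nat. real n / 2 < real k \<and> k < n \<longrightarrow>
    (\<exists>L. convex_body n L \<and> john_position n L \<and>
      vol k (L \<inter> span (std_basis ` {..<k}))
        = (real n / real k) powr (real k / 2) * vol k (cube k) \<and>
      (real n / real k) powr (real k / 2) * vol k (cube k)
        > 2 powr ((real n - real k) / 2) * vol k (cube k))"
proof
  fix K :: nat
  define k :: nat where "k = 2 ^ K"
  obtain h :: "nat \<Rightarrow> nat \<Rightarrow> real" where sign: "\<And>i j. (h i j)\<^sup>2 = 1"
    and orth: "\<And>a b. a < k \<Longrightarrow> b < k \<Longrightarrow> (\<Sum>i<k. h i a * h i b) = (if a = b then real k else 0)"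
    using Ex_Hadamard[of K] unfolding k_def of_nat_power of_nat_numeral by metis
  have "\<exists>L. convex_body n L \<and> john_position n L \<and>
      vol k (L \<inter> span (std_basis ` {..<k}))
        = (real n / real k) powr (real k / 2) * vol k (cube k) \<and>
      (real n / real k) powr (real k / 2) * vol k (cube k)
        > 2 powr ((real n - real k) / 2) * vol k (cube k)"
    if n: "real n / 2 < real k \<and> k < n" for n
  proof -
    have "real n < real (2 * k)" using n by simp
    then have k: "0 < k" "k < n" "n < 2 * k" using n by (auto simp: k_def simp flip: of_nat_mult)
    let ?L = "symmetric_body n ({..<k} \<times> {1, -1}) (contact_point h k n)"
    interpret john_decomposition n "{..<k} \<times> {1, -1}" "contact_point h k n" "\<lambda>_. real n / (2 * real k)"
      by (rule john_decomposition_contact_point[OF k sign orth])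
    let ?t = "real n / real k"
    have t: "1 < ?t" "?t < 2" using k by (auto simp: field_simps)
    have "sqrt ?t ^ k = sqrt ?t powr real k"
      using t by (subst powr_realpow) auto
    moreover have "sqrt ?t powr real k = ?t powr (real k / 2)"
      using t by (simp add: powr_powr flip: powr_half_sqrt)
    ultimately have "vol k (?L \<inter> span (std_basis ` {..<k})) = ?t powr (real k / 2) * vol k (cube k)"
      using t vol_scaled_cube[of "sqrt ?t" k] k by (simp add: span_std_basis contact_body_section)
    moreover have "(real n - real k) / 2 = (?t - 1) * (real k / 2)"
      using k by (simp add: field_simps)
    then have "2 powr ((real n - real k) / 2) = (2 powr (?t - 1)) powr (real k / 2)"
      by (simp only: powr_powr)
    then have "2 powr ((real n - real k) / 2) < ?t powr (real k / 2)"
      using two_powr_less[OF t] k by (simp add: powr_less_mono2)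
    then have "2 powr ((real n - real k) / 2) * vol k (cube k) < ?t powr (real k / 2) * vol k (cube k)"
      by (simp add: vol_cube)
    ultimately show ?thesis
      using convex_body_symmetric_body john_position_symmetric_body by blast
  qed
  moreover have "k \<ge> K" by (simp add: k_def less_imp_le[OF less_exp])
  ultimately show "\<exists>k\<ge>K. \<forall>n::nat. real n / 2 < real k \<and> k < n \<longrightarrow>
    (\<exists>L. convex_body n L \<and> john_position n L \<and>
      vol k (L \<inter> span (std_basis ` {..<k}))
        = (real n / real k) powr (real k / 2) * vol k (cube k) \<and>
      (real n / real k) powr (real k / 2) * vol k (cube k)
        > 2 powr ((real n - real k) / 2) * vol k (cube k))"
    by blast
qed

end
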